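(* Let $n,d\ge1$ and let \[p(z_1,\dots,z_n)=\sum_{k=1}^d\ \sum_{i_1,\dots,i_k=1}^n a_{e_{i_1}+\cdots+e_{i_k}}z_{i_1}\cdots z_{i_k}\] be a complex polynomial of degree $d$. For $1\le k\le d$ let \[p_k=\sum_{i_1,\dots,i_k=1}^n a_{e_{i_1}+\cdots+e_{i_k}}\prod_{r=1}^k z_{n-i_r+1}z_{n-i_r+2}\cdots z_{n-1}.\] If there exists a holomorphic function $q$ on $\mathbb D^n$ with $q^{(I)}(\boldsymbol 0)=0$ for all multi-indices $I$ with $|I|\le d$ and $\sup_{\mathbb D^n}|p+q|\le1$, then $\mathscr T(M_{p_1},\dots,M_{p_d})$ is a contraction.
   Context: $\mathbb D$ is the open unit disc, $\mathbb T$ the unit circle. $e_j$ is the row vector of length $n$ with $1$ in position $j$ and $0$ elsewhere; the coefficients $a_{\boldsymbol\alpha}$ are indexed by multi-indices $\boldsymbol\alpha\in\mathbb N_0^n$. The monomial $z_{n-i+1}z_{n-i+2}\cdots z_{n-1}$ is the product of the last $i-1$ of the variables $z_1,\dots,z_{n-1}$, and equals $1$ when $i=1$. $M_{p_k}$ is multiplication by $p_k$ on $L^2(\mathbb T^{n-1})$ (for $n=1$, $L^2(\mathbb T^0)=\mathbb C$). $q^{(I)}=\partial_1^{i_1}\cdots\partial_n^{i_n}q$ for $I=(i_1,\dots,i_n)$, $|I|=i_1+\cdots+i_n$. For operators $A_1,\dots,A_d$ on a Hilbert space $\mathbb H$, $\mathscr T(A_1,\dots,A_d)$ is the $d\times d$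 block upper triangular Toeplitz operator on $\mathbb H\otimes\mathbb C^d$ whose $(i,j)$ block is $A_{j-i+1}$ for $j\ge i$ and $0$ for $j<i$. *)

theory Defs
  imports "HOL-Analysis.Analysis"
begin

text \<open>
  Since the statement relates \<open>n\<close> variables to \<open>n - 1\<close> variables, points of \<open>\<complex>\<^sup>n\<close> are functions
  \<^typ>\<open>nat \<Rightarrow> complex\<close> on the index set \<open>{1..n}\<close>, extensional (\<^const>\<open>PiE\<close>) outside of it.
  Multi-indices are functions \<^typ>\<open>nat \<Rightarrow> nat\<close> that vanish outside \<open>{1..n}\<close>.
\<close>

definition multi_indices :: "nat \<Rightarrow> (nat \<Rightarrow> nat) set" where
  "multi_indices n = {\<alpha>. \<forall>j. j \<notin> {1..n} \<longrightarrow> \<alpha> j = 0}"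

definition mi_abs :: "nat \<Rightarrow> (nat \<Rightarrow> nat) \<Rightarrow> nat" where
  "mi_abs n \<alpha> = (\<Sum>j = 1..n. \<alpha> j)"

definition unit_mi :: "nat \<Rightarrow> nat \<Rightarrow> nat" where
  "unit_mi j = (\<lambda>l. if l = j then 1 else 0)"

definition index_tuples :: "nat \<Rightarrow> nat \<Rightarrow> (nat \<Rightarrow> nat) set" where
  "index_tuples n k = ({1..k} \<rightarrow>\<^sub>E {1..n})"

text \<open>\<open>tuple_mi k (i\<^sub>1, \<dots>, i\<^sub>k)\<close> is the multi-index \<open>e\<^bsub>i\<^sub>1\<^esub> + \<dots> + e\<^bsub>i\<^sub>k\<^esub>\<close>.\<close>

definition tuple_mi :: "nat \<Rightarrow> (nat \<Rightarrow> nat) \<Rightarrow> nat \<Rightarrow> nat" where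
  "tuple_mi k i = (\<lambda>l. \<Sum>r = 1..k. unit_mi (i r) l)"

definition poly_fun ::
  "nat \<Rightarrow> nat \<Rightarrow> ((nat \<Rightarrow> nat) \<Rightarrow> complex) \<Rightarrow> (nat \<Rightarrow> complex) \<Rightarrow> complex" where
  "poly_fun n d a z =
     (\<Sum>k = 1..d. \<Sum>i \<in> index_tuples n k. a (tuple_mi k i) * (\<Prod>r = 1..k. z (i r)))"

text \<open>
  The coefficient of the monomial \<open>z\<^sup>\<alpha>\<close> in \<^const>\<open>poly_fun\<close>; it differs from \<open>a \<alpha>\<close> by a multinomial
  coefficient, because the sum runs over ordered tuples.
\<close>

definition poly_fun_coeff ::
  "nat \<Rightarrow> nat \<Rightarrow> ((nat \<Rightarrow> nat) \<Rightarrow> complex) \<Rightarrow> (nat \<Rightarrow> nat) \<Rightarrow> complex" where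
  "poly_fun_coeff n d a \<alpha> =
     (\<Sum>k = 1..d. \<Sum>i \<in> {i \<in> index_tuples n k. tuple_mi k i = \<alpha>}. a (tuple_mi k i))"

definition poly_fun_has_degree :: "nat \<Rightarrow> nat \<Rightarrow> ((nat \<Rightarrow> nat) \<Rightarrow> complex) \<Rightarrow> nat \<Rightarrow> bool" where
  "poly_fun_has_degree n d a m \<longleftrightarrow>
     (\<exists>\<alpha> \<in> multi_indices n. poly_fun_coeff n d a \<alpha> \<noteq> 0 \<and> mi_abs n \<alpha> = m) \<and>
     (\<forall>\<alpha> \<in> multi_indices n. poly_fun_coeff n d a \<alpha> \<noteq> 0 \<longrightarrow> mi_abs n \<alpha> \<le> m)"

text \<open>
  The function \<open>p\<^sub>k\<close> of the variables \<open>z\<^sub>1, \<dots>, z\<^bsub>n-1\<^esub>\<close>. For \<open>i r = 1\<close> the inner product is empty.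
\<close>

definition torus_poly ::
  "nat \<Rightarrow> ((nat \<Rightarrow> nat) \<Rightarrow> complex) \<Rightarrow> nat \<Rightarrow> (nat \<Rightarrow> complex) \<Rightarrow> complex" where
  "torus_poly n a k z =
     (\<Sum>i \<in> index_tuples n k. a (tuple_mi k i) * (\<Prod>r = 1..k. \<Prod>j = n - i r + 1..n - 1. z j))"

definition polydisc :: "nat \<Rightarrow> (nat \<Rightarrow> complex) set" where
  "polydisc n = ({1..n} \<rightarrow>\<^sub>E ball 0 1)"

definition origin :: "nat \<Rightarrow> nat \<Rightarrow> complex" where
  "origin n = (\<lambda>j \<in> {1..n}. 0)"

text \<open>
  Holomorphy on the polydisc: at every point \<open>z\<close> there is a complex-linear total derivative
  \<open>h \<mapsto> \<Sum>\<^sub>j c\<^sub>j h\<^sub>j\<close>. It is spelled out because the type of points is not a normed space, so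
  \<^const>\<open>has_derivative\<close> does not apply.
\<close>

definition holomorphic_on_polydisc :: "nat \<Rightarrow> ((nat \<Rightarrow> complex) \<Rightarrow> complex) \<Rightarrow> bool" where
  "holomorphic_on_polydisc n f \<longleftrightarrow>
     (\<forall>z \<in> polydisc n. \<exists>c :: nat \<Rightarrow> complex. \<forall>\<epsilon> > 0. \<exists>\<delta> > 0. \<forall>w \<in> polydisc n.
        L2_set (\<lambda>j. cmod (w j - z j)) {1..n} < \<delta> \<longrightarrow>
        cmod (f w - f z - (\<Sum>j = 1..n. c j * (w j - z j)))
          \<le> \<epsilon> * L2_set (\<lambda>j. cmod (w j - z j)) {1..n})"

definition partial_deriv ::
  "nat \<Rightarrow> ((nat \<Rightarrow> complex) \<Rightarrow> complex) \<Rightarrow> (nat \<Rightarrow> complex) \<Rightarrow> complex" where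
  "partial_deriv j f = (\<lambda>z. deriv (\<lambda>t. f (z(j := t))) (z j))"

text \<open>\<open>multi_deriv n I f\<close> is \<open>\<partial>\<^sub>1\<^bsup>I 1\<^esup> \<dots> \<partial>\<^sub>n\<^bsup>I n\<^esup> f\<close>, with \<open>\<partial>\<^sub>n\<close> applied first.\<close>

definition multi_deriv ::
  "nat \<Rightarrow> (nat \<Rightarrow> nat) \<Rightarrow> ((nat \<Rightarrow> complex) \<Rightarrow> complex) \<Rightarrow> (nat \<Rightarrow> complex) \<Rightarrow> complex" where
  "multi_deriv n I f = foldr (\<lambda>j. partial_deriv j ^^ I j) [1..<Suc n] f"

definition circle_measure :: "complex measure" where
  "circle_measure =
     distr (uniform_measure lborel {0..<2 * pi}) (restrict_space borel (sphere 0 1)) cis"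

text \<open>
  Normalised Lebesgue measure on \<open>\<T>\<^sup>m\<close>, with coordinates indexed by \<open>{1..m}\<close>. For \<open>m = 0\<close> it is the
  unit mass on a one-point space, whose \<open>L\<^sup>2\<close>-space is \<open>\<complex>\<close>.
\<close>

definition torus_measure :: "nat \<Rightarrow> (nat \<Rightarrow> complex) measure" where
  "torus_measure m = PiM {1..m} (\<lambda>_. circle_measure)"

text \<open>
  Elements of \<open>L\<^sup>2(M)\<close> are represented by square-integrable functions; equality in \<open>L\<^sup>2(M)\<close> is equality
  almost everywhere. The Hilbert space \<open>L\<^sup>2(M) \<otimes> \<complex>\<^sup>d\<close> is the space of \<open>d\<close>-tuples of such functions,
  indexed by \<open>{1..d}\<close>, with the Hilbert direct sum norm.
\<close>

definition L2_space :: "'a measure \<Rightarrow> ('a \<Rightarrow> complex) set" where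
  "L2_space M = {f \<in> borel_measurable M. integrable M (\<lambda>t. (cmod (f t))\<^sup>2)}"

definition L2_norm :: "'a measure \<Rightarrow> ('a \<Rightarrow> complex) \<Rightarrow> real" where
  "L2_norm M f = sqrt (LINT t|M. (cmod (f t))\<^sup>2)"

definition L2_tuples :: "'a measure \<Rightarrow> nat \<Rightarrow> (nat \<Rightarrow> 'a \<Rightarrow> complex) set" where
  "L2_tuples M d = ({1..d} \<rightarrow>\<^sub>E L2_space M)"

definition L2_tuple_norm :: "'a measure \<Rightarrow> nat \<Rightarrow> (nat \<Rightarrow> 'a \<Rightarrow> complex) \<Rightarrow> real" where
  "L2_tuple_norm M d x = L2_set (\<lambda>j. L2_norm M (x j)) {1..d}"

definition mult_op :: "('a \<Rightarrow> complex) \<Rightarrow> ('a \<Rightarrow> complex) \<Rightarrow> 'a \<Rightarrow> complex" where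
  "mult_op \<phi> f = (\<lambda>t. \<phi> t * f t)"

definition block_op ::
  "nat \<Rightarrow> (nat \<Rightarrow> nat \<Rightarrow> ('a \<Rightarrow> complex) \<Rightarrow> ('a \<Rightarrow> complex)) \<Rightarrow>
   (nat \<Rightarrow> 'a \<Rightarrow> complex) \<Rightarrow> (nat \<Rightarrow> 'a \<Rightarrow> complex)" where
  "block_op d B x = (\<lambda>i \<in> {1..d}. \<lambda>t. \<Sum>j = 1..d. B i j (x j) t)"

definition toeplitz_op ::
  "nat \<Rightarrow> (nat \<Rightarrow> ('a \<Rightarrow> complex) \<Rightarrow> ('a \<Rightarrow> complex)) \<Rightarrow>
   (nat \<Rightarrow> 'a \<Rightarrow> complex) \<Rightarrow> (nat \<Rightarrow> 'a \<Rightarrow> complex)" where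
  "toeplitz_op d A =
     block_op d (\<lambda>i j. if i \<le> j then A (j - i + 1) else (\<lambda>f t. 0))"

text \<open>
  A contraction is a linear operator of norm at most 1. Linearity is required up to almost everywhere
  equality; together with the norm bound it makes the operator respect almost everywhere equality.
\<close>

definition L2_contraction ::
  "'a measure \<Rightarrow> nat \<Rightarrow> ((nat \<Rightarrow> 'a \<Rightarrow> complex) \<Rightarrow> (nat \<Rightarrow> 'a \<Rightarrow> complex)) \<Rightarrow> bool" where
  "L2_contraction M d S \<longleftrightarrow>
     (\<forall>x \<in> L2_tuples M d. S x \<in> L2_tuples M d) \<and>
     (\<forall>x \<in> L2_tuples M d. \<forall>y \<in> L2_tuples M d. \<forall>c. \<forall>i \<in> {1..d}.
        AE t in M. S (\<lambda>j \<in> {1..d}. \<lambda>s. c * x j s + y j s) i t = c * S x i t + S y i t) \<and>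
     (\<forall>x \<in> L2_tuples M d. L2_tuple_norm M d (S x) \<le> L2_tuple_norm M d x)"

end

theory Submission
  imports Defs "HOL-Complex_Analysis.Complex_Analysis" "HOL-Real_Asymp.Real_Asymp"
begin

text \<open>
  Fix a point \<open>t\<close> of the torus and put \<open>w\<^sub>i = t\<^bsub>n-i+1\<^esub> \<cdots> t\<^bsub>n-1\<^esub>\<close>, so that \<open>\<bar>w\<^sub>i\<bar> = 1\<close>. Along the line
  \<open>z \<mapsto> z w\<close> the function \<open>p + q\<close> is holomorphic, bounded by \<open>1\<close>, and has the Taylor expansion
  \<open>\<Sum>\<^sub>k p\<^sub>k(t) z\<^sup>k + O(z\<^bsup>d+1\<^esup>)\<close>. Multiplying it by the polynomial \<open>\<Sum>\<^sub>j x\<^sub>j z\<^bsup>d-j\<^esup>\<close> and comparing Taylor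
  coefficients in the Hardy space norm shows that the scalar Toeplitz matrix of
  \<open>p\<^sub>1(t), \<dots>, p\<^sub>d(t)\<close> is a contraction; integration over \<open>t\<close> gives the theorem.

  That \<open>q(z w) = O(z\<^bsup>d+1\<^esup>)\<close> is proved by Taylor expansion in one variable at a time. This needs only a
  class of functions closed under partial derivatives: separately holomorphic ones that are bounded
  on smaller polydiscs. The function \<open>q\<close> belongs to it because \<open>p + q\<close> and \<open>p\<close> are bounded.
\<close>

section \<open>Circle means and Hardy space inequalities in one variable\<close>

text \<open>Cauchy's integral formula at the centre: along the circle, the velocity of the path
  divided by its position is the constant \<open>2 * pi * \<i>\<close>.\<close>

lemma circle_mean_value:
  assumes "continuous_on (cball 0 r) G" "G holomorphic_on ball 0 r" "r > 0"
  shows "((\<lambda>t. G (circlepath 0 r t)) has_integral G 0) {0..1}"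
proof -
  have "((\<lambda>u. G u / (u - 0)) has_contour_integral (2 * of_real pi * \<i> * G 0)) (circlepath 0 r)"
    using assms by (intro Cauchy_integral_circlepath) auto
  then have "((\<lambda>t. G (circlepath 0 r t) / circlepath 0 r t * (2 * pi * \<i> * r * exp (2 * pi * \<i> * t)))
      has_integral (2 * of_real pi * \<i> * G 0)) {0..1}"
    by (simp add: has_contour_integral vector_derivative_circlepath)
  moreover have "G (circlepath 0 r t) / circlepath 0 r t * (2 * pi * \<i> * r * exp (2 * pi * \<i> * t))
      = 2 * of_real pi * \<i> * G (circlepath 0 r t)" for t
    using assms(3) by (simp add: circlepath)
  ultimately have "((\<lambda>t. 2 * of_real pi * \<i> * G (circlepath 0 r t))
      has_integral (2 * of_real pi * \<i> * G 0)) {0..1}"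
    by (simp add: mult_ac)
  from has_integral_mult_right[OF this, of "1 / (2 * of_real pi * \<i>)"] show ?thesis
    by simp
qed

lemma norm_circlepath_0: "r > 0 \<Longrightarrow> cmod (circlepath 0 r t) = r"
  by (simp add: circlepath norm_mult norm_exp_eq_Re)

text \<open>On the circle \<open>z * cnj z = r ^ 2\<close>, so the conjugated power cancels
  \<open>m\<close> of the \<open>e\<close> factors. What remains is
  \<open>r ^ (2 * m) * z ^ (e - m) * G z\<close>, a holomorphic function whose mean is its value at
  0.\<close>

lemma circle_mean_mult_cnj_power:
  assumes "continuous_on (cball 0 r) G" "G holomorphic_on ball 0 r" "r > 0" "m \<le> e"
  shows "((\<lambda>t. circlepath 0 r t ^ e * G (circlepath 0 r t) * cnj (circlepath 0 r t ^ m))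
           has_integral (if m = e then r ^ (2 * m) * G 0 else 0)) {0..1}"
proof -
  let ?H = "\<lambda>z. of_real (r ^ (2 * m)) * (z ^ (e - m) * G z)"
  have *: "((\<lambda>t. ?H (circlepath 0 r t)) has_integral ?H 0) {0..1}"
    using assms by (intro circle_mean_value continuous_intros holomorphic_intros) auto
  have "?H z = z ^ e * G z * cnj (z ^ m)" if "cmod z = r" for z
  proof -
    have "z ^ e * cnj (z ^ m) = z ^ (e - m) * (z * cnj z) ^ m"
      using \<open>m \<le> e\<close> by (simp add: power_mult_distrib flip: power_add mult.assoc)
    also have "z * cnj z = of_real (r ^ 2)"
      using that complex_norm_square[of z] by simp
    finally show ?thesis
      by (simp add: mult_ac flip: power_mult)
  qed
  then have "?H (circlepath 0 r t) = circlepath 0 r t ^ e * G (circlepath 0 r t) * cnj (circlepath 0 r t ^ m)" for t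
    using \<open>r > 0\<close> by (simp only: norm_circlepath_0)
  moreover have "?H 0 = (if m = e then r ^ (2 * m) * G 0 else 0)"
    using \<open>m \<le> e\<close> by simp
  ultimately show ?thesis
    using * by (simp only: of_real_power)
qed

text \<open>Parseval's identity: in the double sum for the squared modulus, only the diagonal
  survives integration.\<close>

lemma circle_mean_norm_poly_squared:
  fixes b :: "nat \<Rightarrow> complex"
  assumes "r > 0"
  shows "((\<lambda>t. (cmod (\<Sum>m\<le>d. b m * circlepath 0 r t ^ m))\<^sup>2)
           has_integral (\<Sum>m\<le>d. (cmod (b m))\<^sup>2 * r ^ (2 * m))) {0..1}"
proof -
  let ?c = "circlepath 0 r"
  have orth: "((\<lambda>t. ?c t ^ k * cnj (?c t ^ m)) has_integral
      of_real (if m = k then r ^ (2 * m) else 0)) {0..1}" for k m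
  proof (cases "m \<le> k")
    case True
    then show ?thesis
      using circle_mean_mult_cnj_power[of r "\<lambda>_. 1" m k] assms by (simp split: if_splits)
  next
    case False
    then have "((\<lambda>t. ?c t ^ m * cnj (?c t ^ k)) has_integral 0) {0..1}"
      using circle_mean_mult_cnj_power[of r "\<lambda>_. 1" k m] assms by simp
    from has_integral_linear[OF this bounded_linear_cnj] show ?thesis
      using False by (auto simp: o_def mult.commute)
  qed
  have "((\<lambda>t. \<Sum>k\<le>d. \<Sum>m\<le>d. b k * cnj (b m) * (?c t ^ k * cnj (?c t ^ m))) has_integral
      (\<Sum>k\<le>d. \<Sum>m\<le>d. b k * cnj (b m) * of_real (if m = k then r ^ (2 * m) else 0))) {0..1}"
    by (intro has_integral_sum has_integral_mult_right orth) auto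
  from has_integral_linear[OF this bounded_linear_Re]
  have "((\<lambda>t. Re (\<Sum>k\<le>d. \<Sum>m\<le>d. b k * cnj (b m) * (?c t ^ k * cnj (?c t ^ m)))) has_integral
      Re (\<Sum>k\<le>d. \<Sum>m\<le>d. b k * cnj (b m) * of_real (if m = k then r ^ (2 * m) else 0))) {0..1}"
    by (simp add: o_def)
  moreover have "(\<Sum>k\<le>d. \<Sum>m\<le>d. b k * cnj (b m) * (z ^ k * cnj (z ^ m)))
      = of_real ((cmod (\<Sum>m\<le>d. b m * z ^ m))\<^sup>2)" for z
    unfolding complex_norm_square by (simp add: sum_product mult_ac)
  moreover have "(\<Sum>k\<le>d. \<Sum>m\<le>d. b k * cnj (b m) * of_real (if m = k then r ^ (2 * m) else 0))
      = of_real (\<Sum>m\<le>d. (cmod (b m))\<^sup>2 * r ^ (2 * m))"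
    unfolding of_real_sum of_real_mult complex_norm_square by (simp add: if_distrib cong: if_cong)
  ultimately show ?thesis
    by (simp only: Re_complex_of_real)
qed

text \<open>Bessel's inequality on a circle: modulo the part of order \<open>> d\<close>, the polynomial \<open>c\<close> is the
  orthogonal projection of a function dominated by \<open>b\<close>.\<close>

lemma taylor_coeffs_norm_le:
  fixes b c :: "nat \<Rightarrow> complex"
  assumes S: "S holomorphic_on ball 0 1" "S 0 = 0"
    and le: "\<And>z. cmod z < 1 \<Longrightarrow> cmod ((\<Sum>m\<le>d. c m * z ^ m) + z ^ d * S z) \<le> cmod (\<Sum>m\<le>d. b m * z ^ m)"
  shows "(\<Sum>m\<le>d. (cmod (c m))\<^sup>2) \<le> (\<Sum>m\<le>d. (cmod (b m))\<^sup>2)"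
proof -
  \<comment> \<open>\<open>S\<close> is only given on the open disc, so the comparison is made on
    circles of radius \<open>r < 1\<close>, followed by \<open>r\<close> tending to 1.\<close>
  have *: "(\<Sum>m\<le>d. (cmod (c m))\<^sup>2 * r ^ (2 * m)) \<le> (\<Sum>m\<le>d. (cmod (b m))\<^sup>2)" if "0 < r" "r < 1" for r :: real
  proof -
    let ?c = "circlepath 0 r"
    have cont: "continuous_on (cball 0 r) S" and hol: "S holomorphic_on ball 0 r"
      using S(1) \<open>r < 1\<close>
      by (auto intro!: holomorphic_on_imp_continuous_on elim!: holomorphic_on_subset)
    let ?Q = "\<lambda>z. \<Sum>m\<le>d. c m * z ^ m"
    \<comment> \<open>The tail \<open>z ^ d * S z\<close> is orthogonal to each \<open>z ^ m\<close>
      with \<open>m \<le> d\<close>. For \<open>m = d\<close> the mean is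
      \<open>r ^ (2 * d) * S 0\<close>, which vanishes because \<open>S 0 = 0\<close>.\<close>
    have "((\<lambda>t. \<Sum>m\<le>d. cnj (c m) * (?c t ^ d * S (?c t) * cnj (?c t ^ m))) has_integral
        (\<Sum>m\<le>d. cnj (c m) * 0)) {0..1}"
    proof (intro has_integral_sum has_integral_mult_right)
      fix m assume "m \<in> {..d}"
      then show "((\<lambda>t. ?c t ^ d * S (?c t) * cnj (?c t ^ m)) has_integral 0) {0..1}"
        using circle_mean_mult_cnj_power[OF cont hol \<open>0 < r\<close>, of m d] S(2) by (auto split: if_splits)
    qed simp
    then have "((\<lambda>t. cnj (?Q (?c t)) * (?c t ^ d * S (?c t))) has_integral 0) {0..1}"
      by (simp add: sum_distrib_left sum_distrib_right mult_ac)
    from has_integral_linear[OF this bounded_linear_Re]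
    have cross: "((\<lambda>t. Re (cnj (?Q (?c t)) * (?c t ^ d * S (?c t)))) has_integral 0) {0..1}"
      by (simp add: o_def)
    have "(\<Sum>m\<le>d. (cmod (c m))\<^sup>2 * r ^ (2 * m)) + 2 * 0 \<le> (\<Sum>m\<le>d. (cmod (b m))\<^sup>2 * r ^ (2 * m))"
    proof (rule has_integral_le)
      show "((\<lambda>t. (cmod (?Q (?c t)))\<^sup>2 + 2 * Re (cnj (?Q (?c t)) * (?c t ^ d * S (?c t))))
          has_integral (\<Sum>m\<le>d. (cmod (c m))\<^sup>2 * r ^ (2 * m)) + 2 * 0) {0..1}"
        by (intro has_integral_add circle_mean_norm_poly_squared \<open>0 < r\<close>
            has_integral_mult_right cross)
      show "((\<lambda>t. (cmod (\<Sum>m\<le>d. b m * ?c t ^ m))\<^sup>2) has_integral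
          (\<Sum>m\<le>d. (cmod (b m))\<^sup>2 * r ^ (2 * m))) {0..1}"
        by (intro circle_mean_norm_poly_squared \<open>0 < r\<close>)
      fix t
      let ?z = "?c t"
      \<comment> \<open>Discarding the square of the tail pointwise avoids integrating it; only the
        cross term, of mean 0, is kept.\<close>
      have sq: "(cmod u)\<^sup>2 + 2 * Re (cnj u * v) + (cmod v)\<^sup>2 = (cmod (u + v))\<^sup>2" for u v
        unfolding cmod_power2 by (simp add: algebra_simps power2_eq_square)
      have "(cmod (?Q ?z))\<^sup>2 + 2 * Re (cnj (?Q ?z) * (?z ^ d * S ?z)) \<le> (cmod (?Q ?z + ?z ^ d * S ?z))\<^sup>2"
        using sq[of "?Q ?z" "?z ^ d * S ?z"] zero_le_power2[of "cmod (?z ^ d * S ?z)"] by linarith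
      also have "\<dots> \<le> (cmod (\<Sum>m\<le>d. b m * ?z ^ m))\<^sup>2"
        using that by (intro power_mono le) (auto simp: norm_circlepath_0)
      finally show "(cmod (?Q ?z))\<^sup>2 + 2 * Re (cnj (?Q ?z) * (?z ^ d * S ?z)) \<le> (cmod (\<Sum>m\<le>d. b m * ?z ^ m))\<^sup>2" .
    qed
    also have "\<dots> \<le> (\<Sum>m\<le>d. (cmod (b m))\<^sup>2 * 1)"
      using that by (intro sum_mono mult_left_mono power_le_one) auto
    finally show ?thesis by simp
  qed
  have "((\<lambda>r::real. \<Sum>m\<le>d. (cmod (c m))\<^sup>2 * r ^ (2 * m)) \<longlongrightarrow> (\<Sum>m\<le>d. (cmod (c m))\<^sup>2 * 1 ^ (2 * m))) (at_left 1)"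
    by (intro tendsto_intros)
  moreover have "\<forall>\<^sub>F r in at_left (1::real). 0 < r \<and> r < 1"
    using eventually_at_left[of 0 "1::real"] by (auto intro: exI[of _ 0])
  then have "\<forall>\<^sub>F r in at_left (1::real). (\<Sum>m\<le>d. (cmod (c m))\<^sup>2 * r ^ (2 * m)) \<le> (\<Sum>m\<le>d. (cmod (b m))\<^sup>2)"
    by (rule eventually_mono) (use * in auto)
  ultimately show ?thesis
    using tendsto_upperbound[of _ _ "at_left (1::real)"] by fastforce
qed

text \<open>The quotient is \<open>R z / z ^ d\<close> rather than \<open>R z / z ^ (d + 1)\<close> because its value at the
  singularity is then known to be \<open>0\<close>.\<close>

lemma holomorphic_factor_power:
  assumes R: "R holomorphic_on ball 0 1"
    and bound: "\<And>z. cmod z \<le> 1/2 \<Longrightarrow> cmod (R z) \<le> C * cmod z ^ Suc d"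
  obtains S where "S holomorphic_on ball 0 1" "S 0 = 0" "\<And>z. R z = z ^ d * S z"
proof
  let ?S = "\<lambda>z. if z = 0 then 0 else R z / z ^ d"
  have "(\<lambda>z. R z / z ^ d) \<midarrow>0\<rightarrow> 0"
  proof (rule Lim_null_comparison)
    have "\<forall>\<^sub>F z in at (0::complex). z \<noteq> 0 \<and> cmod z < 1/2"
      by (auto simp: eventually_at intro: exI[of _ "1/2"])
    then show "\<forall>\<^sub>F z in at (0::complex). cmod (R z / z ^ d) \<le> C * cmod z"
    proof (rule eventually_mono)
      fix z :: complex assume z: "z \<noteq> 0 \<and> cmod z < 1/2"
      then have "cmod (R z) \<le> C * cmod z * cmod z ^ d"
        using bound[of z] by (simp add: mult_ac)
      then show "cmod (R z / z ^ d) \<le> C * cmod z"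
        using z by (simp add: norm_divide norm_power divide_le_eq)
    qed
    show "((\<lambda>z. C * cmod z) \<longlongrightarrow> 0) (at (0::complex))"
      by (auto intro!: tendsto_eq_intros)
  qed
  then show "?S holomorphic_on ball 0 1"
    using R by (intro removable_singularity holomorphic_intros) (auto intro: holomorphic_on_subset)
  show "?S 0 = 0" by simp
  have "R 0 = 0" using bound[of 0] by simp
  then show "R z = z ^ d * ?S z" for z by simp
qed

section \<open>Separately holomorphic functions and their partial derivatives\<close>

text \<open>Bounds are asked only on smaller polydiscs because Cauchy estimates deteriorate at the
  boundary: a derivative of a bounded function may be unbounded on the whole polydisc.\<close>

definition bounded_on_compacts :: "nat \<Rightarrow> ((nat \<Rightarrow> complex) \<Rightarrow> complex) \<Rightarrow> bool" where
  "bounded_on_compacts n f \<longleftrightarrow>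
     (\<forall>r<1. \<exists>B. \<forall>z \<in> polydisc n. (\<forall>j\<in>{1..n}. cmod (z j) \<le> r) \<longrightarrow> cmod (f z) \<le> B)"

definition sep_holomorphic :: "nat \<Rightarrow> ((nat \<Rightarrow> complex) \<Rightarrow> complex) \<Rightarrow> bool" where
  "sep_holomorphic n f \<longleftrightarrow> bounded_on_compacts n f \<and>
     (\<forall>z \<in> polydisc n. \<forall>j\<in>{1..n}. (\<lambda>t. f (z(j := t))) holomorphic_on ball 0 1)"

lemma sep_holomorphic_bound:
  assumes "sep_holomorphic n f" "r < 1"
  obtains B where "\<And>z. z \<in> polydisc n \<Longrightarrow> (\<forall>i\<in>{1..n}. cmod (z i) \<le> r) \<Longrightarrow> cmod (f z) \<le> B"
  using assms unfolding sep_holomorphic_def bounded_on_compacts_def by blast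

lemma polydisc_upd: "z \<in> polydisc n \<Longrightarrow> j \<in> {1..n} \<Longrightarrow> cmod t < 1 \<Longrightarrow> z(j := t) \<in> polydisc n"
  by (auto simp: polydisc_def PiE_def extensional_def Pi_def)

lemma polydisc_norm_less: "z \<in> polydisc n \<Longrightarrow> j \<in> {1..n} \<Longrightarrow> cmod (z j) < 1"
  by (auto simp: polydisc_def PiE_def Pi_def)

text \<open>A circle of radius \<open>(1 - r) / 2\<close> about \<open>s\<close> stays within
  modulus \<open>(1 + r) / 2\<close>, halfway between \<open>r\<close> and the boundary. The radius
  depends on \<open>r\<close> only, so the estimate is uniform in \<open>s\<close>.\<close>

lemma Cauchy_inequality_unit_disc:
  assumes f: "f holomorphic_on ball 0 1" and B: "\<And>z. cmod z \<le> (1 + r) / 2 \<Longrightarrow> cmod (f z) \<le> B"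
    and "cmod s \<le> r" "r < 1"
  shows "cmod ((deriv ^^ k) f s) \<le> fact k * B / ((1 - r) / 2) ^ k"
proof (rule Cauchy_inequality)
  have s: "cmod z \<le> (1 + r) / 2" if "dist s z \<le> (1 - r) / 2" for z
    using norm_triangle_ineq4[of s "s - z"] that assms(3) by (simp add: dist_norm field_simps)
  have sub: "cball s ((1 - r) / 2) \<subseteq> ball 0 1"
  proof
    fix z assume "z \<in> cball s ((1 - r) / 2)"
    with s[of z] assms(4) show "z \<in> ball 0 1" by simp
  qed
  then show "f holomorphic_on ball s ((1 - r) / 2)" "continuous_on (cball s ((1 - r) / 2)) f"
    using f ball_subset_cball[of s "(1 - r) / 2"]
    by (auto intro!: holomorphic_on_imp_continuous_on elim!: holomorphic_on_subset)
  show "0 < (1 - r) / 2" using assms by simp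
  show "cmod (f x) \<le> B" if "cmod (s - x) = (1 - r) / 2" for x
    using B s that by (simp add: dist_norm)
qed

text \<open>One \<open>B\<close> serves all base points, since every circle used lies in the
  polydisc of radius \<open>(1 + r) / 2\<close>, where \<open>f\<close> has a single bound. The case
  \<open>k = 1\<close> bounds a partial derivative; higher \<open>k\<close> bounds a Taylor
  remainder.\<close>

lemma Cauchy_inequality_slice:
  assumes f: "sep_holomorphic n f" and j: "j \<in> {1..n}" and r: "r < 1"
  shows "\<exists>B. \<forall>z \<in> polydisc n. (\<forall>i\<in>{1..n}. cmod (z i) \<le> r) \<longrightarrow>
           cmod ((deriv ^^ k) (\<lambda>t. f (z(j := t))) (z j)) \<le> B"
proof -
  have "(1 + r) / 2 < 1" using r by simp
  with f obtain B where B: "\<And>z. z \<in> polydisc n \<Longrightarrow> (\<forall>i\<in>{1..n}. cmod (z i) \<le> (1 + r) / 2) \<Longrightarrow> cmod (f z) \<le> B"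
    using sep_holomorphic_bound by blast
  show ?thesis
  proof (intro exI ballI impI)
    fix z assume z: "z \<in> polydisc n" "\<forall>i\<in>{1..n}. cmod (z i) \<le> r"
    show "cmod ((deriv ^^ k) (\<lambda>t. f (z(j := t))) (z j)) \<le> fact k * B / ((1 - r) / 2) ^ k"
    proof (rule Cauchy_inequality_unit_disc)
      show "(\<lambda>t. f (z(j := t))) holomorphic_on ball 0 1"
        using f z j by (auto simp: sep_holomorphic_def)
      show "cmod (z j) \<le> r" using z j by auto
      show "r < 1" by fact
      fix t assume t: "cmod t \<le> (1 + r) / 2"
      have "cmod (z i) \<le> (1 + r) / 2" if "i \<in> {1..n}" for i
        using z(2)[rule_format, OF that] r by simp
      then show "cmod (f (z(j := t))) \<le> B"
        using t r by (intro B polydisc_upd z j) auto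
    qed
  qed
qed

text \<open>The difference quotients in the second variable are holomorphic in the first one, and they
  converge locally uniformly because the second derivatives are locally bounded.\<close>

lemma holomorphic_on_deriv_param:
  fixes g :: "complex \<Rightarrow> complex \<Rightarrow> complex"
  assumes g1: "\<And>s. cmod s < 1 \<Longrightarrow> (\<lambda>t. g t s) holomorphic_on ball 0 1"
    and g2: "\<And>t. cmod t < 1 \<Longrightarrow> g t holomorphic_on ball 0 1"
    and bound: "\<And>r. r < 1 \<Longrightarrow> \<exists>B. \<forall>t s. cmod t \<le> r \<longrightarrow> cmod s \<le> r \<longrightarrow> cmod (g t s) \<le> B"
    and s: "cmod s < 1"
  shows "(\<lambda>t. deriv (g t) s) holomorphic_on ball 0 1"
proof -
  \<comment> \<open>Increments tending to 0, never above half the distance from \<open>s\<close> to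
    the circle, so that \<open>s + h m\<close> stays in a fixed smaller disc.\<close>
  define h :: "nat \<Rightarrow> real" where "h m = (1 - cmod s) / 2 / Suc m" for m
  have h: "h m > 0" "h m \<le> (1 - cmod s) / 2" for m
    using s by (auto simp: h_def field_simps intro: mult_left_le)
  have h0: "h \<longlonglongrightarrow> 0"
    unfolding h_def by real_asymp
  have sh: "cmod (s + h m) \<le> (1 + cmod s) / 2" for m
    using norm_triangle_ineq[of s "of_real (h m)"] h[of m] by (simp add: field_simps)
  show ?thesis
  proof (rule holomorphic_uniform_sequence[where f = "\<lambda>m t. (g t (s + h m) - g t s) / of_real (h m)"])
    fix m
    have "cmod (s + h m) < 1" using sh[of m] s by simp
    then show "(\<lambda>t. (g t (s + h m) - g t s) / of_real (h m)) holomorphic_on ball 0 1"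
      using s h[of m] by (intro holomorphic_intros g1) auto
  next
    fix x :: complex assume x: "x \<in> ball 0 1"
    \<comment> \<open>A common radius for the neighbourhood of \<open>x\<close> in the first
      variable and for all points \<open>s + h m\<close> in the second.\<close>
    define \<rho> where "\<rho> = Max {(1 + cmod x) / 2, (1 + cmod s) / 2}"
    have \<rho>: "\<rho> < 1" "(1 + cmod x) / 2 \<le> \<rho>" "(1 + cmod s) / 2 \<le> \<rho>"
      using x s by (auto simp: \<rho>_def)
    then have "(1 + \<rho>) / 2 < 1" by simp
    from bound[OF this] obtain B where
      B: "\<And>t s. cmod t \<le> (1 + \<rho>) / 2 \<Longrightarrow> cmod s \<le> (1 + \<rho>) / 2 \<Longrightarrow> cmod (g t s) \<le> B"
      by blast
    define K where "K = fact 2 * B / ((1 - \<rho>) / 2) ^ 2"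
    have t\<rho>: "cmod t \<le> \<rho>" if "t \<in> cball x ((1 - cmod x) / 2)" for t
      using norm_triangle_ineq4[of x "x - t"] that \<rho> by (simp add: dist_norm field_simps)
    have K: "cmod ((g t (s + h m) - g t s) / of_real (h m) - deriv (g t) s) \<le> K * h m"
      if t: "cmod t \<le> \<rho>" for t m
    proof -
      have gt: "g t holomorphic_on ball 0 1" using g2 t \<rho> by simp
      have Kb: "cmod ((deriv ^^ 2) (g t) z) \<le> K" if "cmod z \<le> \<rho>" for z
        unfolding K_def using t \<rho> that by (intro Cauchy_inequality_unit_disc gt B) auto
      \<comment> \<open>First-order Taylor expansion with remainder
        \<open>K * (h m)\<^sup>2\<close>. Division by \<open>h m\<close> leaves
        \<open>K * h m\<close>, with \<open>K\<close> independent of \<open>t\<close>.\<close>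
      have "cmod ((deriv ^^ 0) (g t) (s + h m)
          - (\<Sum>i\<le>1. (deriv ^^ i) (g t) s * (s + h m - s) ^ i / fact i))
          \<le> K * cmod (s + h m - s) ^ Suc 1 / fact 1"
      proof (rule complex_Taylor[where S = "cball 0 \<rho>" and f = "\<lambda>i. (deriv ^^ i) (g t)"])
        show "((deriv ^^ i) (g t) has_field_derivative (deriv ^^ Suc i) (g t) y) (at y within cball 0 \<rho>)"
          if "y \<in> cball 0 \<rho>" for i y
          using holomorphic_derivI[OF holomorphic_higher_deriv[OF gt open_ball, of i] open_ball, of y] that \<rho>
          by (auto intro: has_field_derivative_at_within)
        show "s \<in> cball 0 \<rho>" using s \<rho> by simp
        show "s + h m \<in> cball 0 \<rho>" using sh[of m] \<rho> by simp
        show "cmod ((deriv ^^ Suc 1) (g t) y) \<le> K" if "y \<in> cball 0 \<rho>" for y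
          using Kb that by (simp add: numeral_2_eq_2)
      qed auto
      then have "cmod (g t (s + h m) - g t s - deriv (g t) s * h m) \<le> K * h m * h m"
        using h[of m] by (simp add: diff_diff_eq power2_eq_square)
      moreover have "(g t (s + h m) - g t s) / of_real (h m) - deriv (g t) s
          = (g t (s + h m) - g t s - deriv (g t) s * h m) / of_real (h m)"
        using h[of m] by (simp add: field_simps)
      ultimately show ?thesis
        using h[of m] by (simp only: norm_divide norm_of_real) (simp add: divide_le_eq)
    qed
    have "uniform_limit (cball x ((1 - cmod x) / 2))
        (\<lambda>m t. (g t (s + h m) - g t s) / of_real (h m)) (\<lambda>t. deriv (g t) s) sequentially"
    proof (rule uniform_limitI)
      fix e :: real assume "e > 0"
      have "(\<lambda>m. K * h m) \<longlonglongrightarrow> 0"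
        using tendsto_mult_right_zero[OF h0] by simp
      with \<open>e > 0\<close> have "\<forall>\<^sub>F m in sequentially. K * h m < e"
        by (auto dest: order_tendstoD)
      then show "\<forall>\<^sub>F m in sequentially. \<forall>t\<in>cball x ((1 - cmod x) / 2).
          dist ((g t (s + h m) - g t s) / of_real (h m)) (deriv (g t) s) < e"
        by (rule eventually_mono) (auto simp: dist_norm intro: le_less_trans[OF K[OF t\<rho>]])
    qed
    moreover have "cball x ((1 - cmod x) / 2) \<subseteq> ball 0 1"
      using t\<rho> \<rho> by fastforce
    ultimately show "\<exists>d>0. cball x d \<subseteq> ball 0 1 \<and> uniform_limit (cball x d)
        (\<lambda>m t. (g t (s + h m) - g t s) / of_real (h m)) (\<lambda>t. deriv (g t) s) sequentially"
      using x by (intro exI[of _ "(1 - cmod x) / 2"]) auto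
  qed auto
qed

text \<open>Boundedness is a Cauchy estimate. In the variable \<open>j\<close> itself the slice is
  the derivative of a holomorphic function; in any other variable
  \<open>holomorphic_on_deriv_param\<close> applies to the two-variable slice.\<close>

lemma sep_holomorphic_partial_deriv:
  assumes f: "sep_holomorphic n f" and j: "j \<in> {1..n}"
  shows "sep_holomorphic n (partial_deriv j f)"
  unfolding sep_holomorphic_def
proof (intro conjI ballI)
  show "bounded_on_compacts n (partial_deriv j f)"
    unfolding bounded_on_compacts_def partial_deriv_def
    using Cauchy_inequality_slice[OF f j, of _ 1] by simp
next
  fix z k assume z: "z \<in> polydisc n" and k: "k \<in> {1..n}"
  show "(\<lambda>t. partial_deriv j f (z(k := t))) holomorphic_on ball 0 1"
  proof (cases "k = j")
    case True
    then show ?thesis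
      using f z j by (auto simp: partial_deriv_def sep_holomorphic_def intro!: holomorphic_deriv)
  next
    case False
    define g where "g t s = f (z(k := t, j := s))" for t s
    have "(\<lambda>t. deriv (g t) (z j)) holomorphic_on ball 0 1"
    proof (rule holomorphic_on_deriv_param)
      show "(\<lambda>t. g t s) holomorphic_on ball 0 1" if "cmod s < 1" for s
        using f k polydisc_upd[OF z j that] False
        unfolding g_def sep_holomorphic_def by (subst fun_upd_twist) auto
      show "g t holomorphic_on ball 0 1" if "cmod t < 1" for t
        using f j polydisc_upd[OF z k that]
        unfolding g_def[abs_def] sep_holomorphic_def by auto
      show "cmod (z j) < 1" using polydisc_norm_less z j .
      fix r :: real assume "r < 1"
      \<comment> \<open>The two-variable slice moves coordinates \<open>k\<close> and
        \<open>j\<close> within radius \<open>r\<close>; this radius also covers the fixed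
        coordinates of \<open>z\<close>.\<close>
      define \<rho> where "\<rho> = Max (insert r ((\<lambda>i. cmod (z i)) ` {1..n}))"
      have "\<rho> < 1" using \<open>r < 1\<close> polydisc_norm_less[OF z] by (auto simp: \<rho>_def)
      then obtain B where B: "\<And>z. z \<in> polydisc n \<Longrightarrow> (\<forall>i\<in>{1..n}. cmod (z i) \<le> \<rho>) \<Longrightarrow> cmod (f z) \<le> B"
        using sep_holomorphic_bound[OF f] by blast
      have "r \<le> \<rho>" "\<And>i. i \<in> {1..n} \<Longrightarrow> cmod (z i) \<le> \<rho>"
        unfolding \<rho>_def by (auto intro!: Max_ge simp del: Max_insert)
      then show "\<exists>B. \<forall>t s. cmod t \<le> r \<longrightarrow> cmod s \<le> r \<longrightarrow> cmod (g t s) \<le> B"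
        unfolding g_def using \<open>r < 1\<close>
        by (intro exI[of _ B] allI impI B polydisc_upd z j k) auto
    qed
    then show ?thesis
      using False by (simp add: partial_deriv_def g_def[abs_def])
  qed
qed

lemma sep_holomorphic_partial_deriv_pow:
  "sep_holomorphic n f \<Longrightarrow> j \<in> {1..n} \<Longrightarrow> sep_holomorphic n ((partial_deriv j ^^ i) f)"
  by (induction i) (auto intro: sep_holomorphic_partial_deriv)

lemma partial_deriv_pow_eq:
  "(partial_deriv j ^^ i) f (z(j := t)) = (deriv ^^ i) (\<lambda>s. f (z(j := s))) t"
proof (induction i arbitrary: t)
  case (Suc i)
  then show ?case
    by (simp only: partial_deriv_def[of j "(partial_deriv j ^^ i) f"] funpow.simps o_apply fun_upd_upd fun_upd_same)
qed simp

section \<open>Order of vanishing at the origin\<close>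

text \<open>Induction on \<open>m\<close>, the number of variables that may be nonzero. The Taylor
  coefficients in variable \<open>Suc m\<close> are, up to factorials, iterated partial derivatives
  at \<open>z (Suc m) = 0\<close>, and the induction hypothesis applies to them with
  \<open>e - i\<close> for \<open>e\<close>. The number \<open>\<rho>\<close> stands for a bound on
  the sup norm of \<open>z\<close>.\<close>

lemma norm_le_power_of_multi_deriv_eq_0:
  assumes "sep_holomorphic n f" "m \<le> n"
    and "\<And>I. I \<in> multi_indices m \<Longrightarrow> mi_abs m I < e \<Longrightarrow> multi_deriv m I f (origin n) = 0"
  shows "\<exists>C. \<forall>\<rho> z. z \<in> polydisc n \<longrightarrow> (\<forall>j\<in>{m<..n}. z j = 0) \<longrightarrow> (\<forall>j\<in>{1..n}. cmod (z j) \<le> \<rho>) \<longrightarrow>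
           \<rho> \<le> 1/2 \<longrightarrow> cmod (f z) \<le> C * \<rho> ^ e"
  using assms
proof (induction m arbitrary: f e)
  case 0
  show ?case
  proof (cases "e = 0")
    case True
    obtain B where "\<And>z. z \<in> polydisc n \<Longrightarrow> (\<forall>i\<in>{1..n}. cmod (z i) \<le> 1/2) \<Longrightarrow> cmod (f z) \<le> B"
      using sep_holomorphic_bound[OF "0.prems"(1), of "1/2"] by auto
    moreover have "\<forall>i\<in>{1..n}. cmod (z i) \<le> 1/2" if "\<forall>i\<in>{1..n}. cmod (z i) \<le> \<rho>" "\<rho> \<le> 1/2" for z :: "nat \<Rightarrow> complex" and \<rho>
      using that order_trans by blast
    ultimately show ?thesis
      using True by (intro exI[of _ B]) simp
  next
    case False
    have "z = origin n" if "z \<in> polydisc n" "\<forall>j\<in>{0<..n}. z j = 0" for z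
      using that by (force simp: origin_def polydisc_def PiE_def extensional_def fun_eq_iff)
    moreover have "f (origin n) = 0"
      using "0.prems"(3)[of "\<lambda>_. 0"] False by (auto simp: multi_indices_def mi_abs_def multi_deriv_def)
    ultimately show ?thesis
      by (intro exI[of _ 0]) auto
  qed
next
  case (Suc m)
  show ?case
  proof (cases e)
    case 0
    obtain B where "\<And>z. z \<in> polydisc n \<Longrightarrow> (\<forall>i\<in>{1..n}. cmod (z i) \<le> 1/2) \<Longrightarrow> cmod (f z) \<le> B"
      using sep_holomorphic_bound[OF Suc.prems(1), of "1/2"] by auto
    moreover have "\<forall>i\<in>{1..n}. cmod (z i) \<le> 1/2" if "\<forall>i\<in>{1..n}. cmod (z i) \<le> \<rho>" "\<rho> \<le> 1/2" for z :: "nat \<Rightarrow> complex" and \<rho>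
      using that order_trans by blast
    ultimately show ?thesis
      using 0 by (intro exI[of _ B]) simp
  next
    case e: (Suc e')
    let ?j = "Suc m"
    let ?g = "\<lambda>i. (partial_deriv ?j ^^ i) f"
    have j: "?j \<in> {1..n}" using Suc.prems by simp
    \<comment> \<open>Exposing the constant as an argument allows one to be chosen for each
      \<open>i\<close>.\<close>
    define P where "P i C \<longleftrightarrow> (\<forall>\<rho> z. z \<in> polydisc n \<longrightarrow> (\<forall>j\<in>{m<..n}. z j = 0) \<longrightarrow>
      (\<forall>j\<in>{1..n}. cmod (z j) \<le> \<rho>) \<longrightarrow> \<rho> \<le> 1/2 \<longrightarrow> cmod (?g i z) \<le> C * \<rho> ^ (e - i))" for i C
    have "\<exists>C. P i C" if "i \<le> e'" for i
      unfolding P_def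
    proof (rule Suc.IH)
      show "sep_holomorphic n (?g i)"
        using Suc.prems j by (intro sep_holomorphic_partial_deriv_pow) auto
      show "m \<le> n" using Suc.prems by simp
      fix I assume I: "I \<in> multi_indices m" "mi_abs m I < e - i"
      \<comment> \<open>\<open>foldr\<close> applies the last list entry first, so the
        \<open>i\<close> derivatives in variable \<open>Suc m\<close> are innermost. This is why
        variables are peeled off from the top.\<close>
      have "multi_deriv m I (?g i) = multi_deriv (Suc m) (I(?j := i)) f"
      proof -
        have "foldr (\<lambda>l. partial_deriv l ^^ I l) [1..<Suc m] u =
            foldr (\<lambda>l. partial_deriv l ^^ (I(?j := i)) l) [1..<Suc m] u" for u
          by (intro foldr_cong) auto
        then show ?thesis
          by (simp add: multi_deriv_def upt_Suc_append[of "Suc 0" "Suc m"] fun_upd_same del: upt_Suc fun_upd_apply)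
      qed
      moreover have "I(?j := i) \<in> multi_indices (Suc m)"
        using I by (auto simp: multi_indices_def)
      moreover have "mi_abs (Suc m) (I(?j := i)) = mi_abs m I + i"
        by (simp add: mi_abs_def)
      ultimately show "multi_deriv m I (?g i) (origin n) = 0"
        using Suc.prems(3)[of "I(?j := i)"] I(2) that by (simp del: fun_upd_apply)
    qed
    then obtain C where C: "\<And>i. i \<le> e' \<Longrightarrow> P i (C i)"
      by metis
    \<comment> \<open>\<open>K\<close> controls the Taylor remainder of order \<open>e\<close> in
      variable \<open>Suc m\<close>, uniformly in the other variables.\<close>
    have "(1/2::real) < 1" by simp
    from Cauchy_inequality_slice[OF Suc.prems(1) j this]
    obtain K where K: "\<forall>z\<in>polydisc n. (\<forall>i\<in>{1..n}. cmod (z i) \<le> 1/2) \<longrightarrow>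
        cmod ((deriv ^^ e) (\<lambda>t. f (z(?j := t))) (z ?j)) \<le> K"
      by (rule exE)
    show ?thesis
    proof (intro exI allI impI)
      fix \<rho> z assume z: "z \<in> polydisc n" "\<forall>j\<in>{Suc m<..n}. z j = 0"
        and \<rho>: "\<forall>j\<in>{1..n}. cmod (z j) \<le> \<rho>" "\<rho> \<le> 1/2"
      have zj: "cmod (z ?j) \<le> \<rho>" using \<rho>(1) j by blast
      then have "\<rho> \<ge> 0" using order_trans[OF norm_ge_zero] by blast
      let ?h = "\<lambda>t. f (z(?j := t))"
      have hol: "?h holomorphic_on ball 0 1"
        using Suc.prems z j by (auto simp: sep_holomorphic_def)
      have K': "cmod ((deriv ^^ e) ?h t) \<le> K" if "cmod t \<le> 1/2" for t
      proof -
        have "cmod ((deriv ^^ e) (\<lambda>s. f ((z(?j := t))(?j := s))) ((z(?j := t)) ?j)) \<le> K"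
        proof (rule K[rule_format])
          show "z(?j := t) \<in> polydisc n" using z j that by (intro polydisc_upd) auto
          show "cmod ((z(?j := t)) l) \<le> 1/2" if "l \<in> {1..n}" for l
            using \<rho>(1)[rule_format, OF that] \<rho>(2) \<open>cmod t \<le> 1/2\<close> by auto
        qed
        then show ?thesis by simp
      qed
      have "K \<ge> 0" by (rule order_trans[OF norm_ge_zero K'[of 0]]) simp
      have "cmod ((deriv ^^ 0) ?h (z ?j) - (\<Sum>i\<le>e'. (deriv ^^ i) ?h 0 * (z ?j - 0) ^ i / fact i))
          \<le> K * cmod (z ?j - 0) ^ Suc e' / fact e'"
      proof (rule complex_Taylor[where S = "cball 0 (1/2)" and f = "\<lambda>i. (deriv ^^ i) ?h"])
        show "((deriv ^^ i) ?h has_field_derivative (deriv ^^ Suc i) ?h y) (at y within cball 0 (1/2))"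
          if "y \<in> cball 0 (1/2)" for i y
          using holomorphic_derivI[OF holomorphic_higher_deriv[OF hol open_ball, of i] open_ball, of y] that
          by (auto intro: has_field_derivative_at_within)
        show "cmod ((deriv ^^ Suc e') ?h y) \<le> K" if "y \<in> cball 0 (1/2)" for y
          using K'[of y] that unfolding e by simp
        show "z ?j \<in> cball 0 (1/2)" using zj \<rho> by simp
      qed auto
      also have "\<dots> \<le> K * \<rho> ^ e / 1"
        using zj \<open>K \<ge> 0\<close> \<open>\<rho> \<ge> 0\<close> unfolding e
        by (intro frac_le mult_mono power_mono) auto
      finally have rem: "cmod (f z - (\<Sum>i\<le>e'. (deriv ^^ i) ?h 0 * z ?j ^ i / fact i)) \<le> K * \<rho> ^ e"
        by simp
      \<comment> \<open>The coefficient contributes \<open>\<rho> ^ (e - i)\<close> and the power of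
        \<open>z ?j\<close> at most \<open>\<rho> ^ i\<close>; the factorial only helps.\<close>
      have "cmod (\<Sum>i\<le>e'. (deriv ^^ i) ?h 0 * z ?j ^ i / fact i) \<le> (\<Sum>i\<le>e'. C i * \<rho> ^ e)"
      proof (rule sum_norm_le)
        fix i assume "i \<in> {..e'}"
        then have i: "i \<le> e'" by simp
        have "(deriv ^^ i) ?h 0 = ?g i (z(?j := 0))"
          by (rule partial_deriv_pow_eq[symmetric])
        moreover have "cmod (?g i (z(?j := 0))) \<le> C i * \<rho> ^ (e - i)"
        proof (rule C[OF i, unfolded P_def, rule_format])
          show "z(?j := 0) \<in> polydisc n" using z j by (intro polydisc_upd) auto
          show "(z(?j := 0)) l = 0" if "l \<in> {m<..n}" for l
            using z that by auto
          show "cmod ((z(?j := 0)) l) \<le> \<rho>" if "l \<in> {1..n}" for l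
            using \<rho> \<open>\<rho> \<ge> 0\<close> that by auto
          show "\<rho> \<le> 1/2" by (rule \<rho>)
        qed
        ultimately have "cmod ((deriv ^^ i) ?h 0) * cmod (z ?j) ^ i \<le> C i * (\<rho> ^ (e - i) * \<rho> ^ i)"
          unfolding mult.assoc[symmetric]
          using zj by (intro mult_mono power_mono) (auto intro: order_trans[OF norm_ge_zero])
        also have "\<rho> ^ (e - i) * \<rho> ^ i = \<rho> ^ e"
          using i e by (subst power_add[symmetric]) simp
        finally have "cmod ((deriv ^^ i) ?h 0 * z ?j ^ i) \<le> C i * \<rho> ^ e"
          by (simp only: norm_mult norm_power)
        moreover have "cmod (u / fact i) \<le> cmod u" for u :: complex
          using divide_left_mono[OF fact_ge_1[of i, where 'a = real] norm_ge_zero[of u]] by (simp add: norm_divide)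
        ultimately show "cmod ((deriv ^^ i) ?h 0 * z ?j ^ i / fact i) \<le> C i * \<rho> ^ e"
          using order_trans by blast
      qed
      from order_trans[OF norm_triangle_sub add_mono[OF this rem]]
      show "cmod (f z) \<le> ((\<Sum>i\<le>e'. C i) + K) * \<rho> ^ e"
        by (simp only: sum_distrib_right distrib_right)
    qed
  qed
qed

section \<open>Restriction to complex lines\<close>

text \<open>The chain rule for an affine line, by hand from the total derivative. It serves both for
  coordinate slices and for lines through the origin.\<close>

lemma holomorphic_on_polydisc_line:
  assumes q: "holomorphic_on_polydisc n q" and U: "open U"
    and mem: "\<And>t. t \<in> U \<Longrightarrow> (\<lambda>j\<in>{1..n}. b j + t * c j) \<in> polydisc n"
  shows "(\<lambda>t. q (\<lambda>j\<in>{1..n}. b j + t * c j)) holomorphic_on U"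
  unfolding holomorphic_on_def field_differentiable_def
proof
  let ?l = "\<lambda>t. \<lambda>j\<in>{1..n}. b j + t * c j"
  fix s assume s: "s \<in> U"
  obtain D where D: "\<And>\<epsilon>. \<epsilon> > 0 \<Longrightarrow> \<exists>\<delta>>0. \<forall>w\<in>polydisc n.
        L2_set (\<lambda>j. cmod (w j - ?l s j)) {1..n} < \<delta> \<longrightarrow>
        cmod (q w - q (?l s) - (\<Sum>j = 1..n. D j * (w j - ?l s j)))
          \<le> \<epsilon> * L2_set (\<lambda>j. cmod (w j - ?l s j)) {1..n}"
    using q mem[OF s] unfolding holomorphic_on_polydisc_def by blast
  \<comment> \<open>Adding 1 to the norm of \<open>c\<close> keeps division by \<open>N\<close>
    legitimate when \<open>c\<close> is zero.\<close>
  define N where "N = L2_set (\<lambda>j. cmod (c j)) {1..n} + 1"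
  have "N \<ge> 1" by (simp add: N_def)
  have L2: "L2_set (\<lambda>j. cmod (?l t j - ?l s j)) {1..n} \<le> N * cmod (t - s)" for t
  proof -
    have "L2_set (\<lambda>j. cmod (?l t j - ?l s j)) {1..n} = L2_set (\<lambda>j. cmod (t - s) * cmod (c j)) {1..n}"
      by (intro L2_set_cong) (simp_all flip: norm_mult left_diff_distrib)
    also have "\<dots> = cmod (t - s) * L2_set (\<lambda>j. cmod (c j)) {1..n}"
      by (simp add: L2_set_right_distrib)
    also have "\<dots> \<le> N * cmod (t - s)"
      by (simp add: N_def algebra_simps)
    finally show ?thesis .
  qed
  have "((\<lambda>t. q (?l t)) has_field_derivative (\<Sum>j=1..n. D j * c j)) (at s within U)"
    unfolding has_field_derivative_def has_derivative_within_alt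
  proof (intro conjI allI impI bounded_linear_mult_right)
    fix e :: real assume "e > 0"
    then have "e / N > 0" using \<open>N \<ge> 1\<close> by simp
    from D[OF this] obtain \<delta> where \<delta>: "\<delta> > 0" "\<And>w. w \<in> polydisc n \<Longrightarrow>
        L2_set (\<lambda>j. cmod (w j - ?l s j)) {1..n} < \<delta> \<Longrightarrow>
        cmod (q w - q (?l s) - (\<Sum>j = 1..n. D j * (w j - ?l s j)))
          \<le> e / N * L2_set (\<lambda>j. cmod (w j - ?l s j)) {1..n}"
      by blast
    show "\<exists>d>0. \<forall>y\<in>U. cmod (y - s) < d \<longrightarrow>
        cmod (q (?l y) - q (?l s) - (\<Sum>j=1..n. D j * c j) * (y - s)) \<le> e * cmod (y - s)"
    proof (intro exI[of _ "\<delta> / N"] conjI ballI impI)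
      show "\<delta> / N > 0" using \<delta> \<open>N \<ge> 1\<close> by simp
      fix y assume y: "y \<in> U" "cmod (y - s) < \<delta> / N"
      have "L2_set (\<lambda>j. cmod (?l y j - ?l s j)) {1..n} < \<delta>"
        using L2[of y] y(2) \<open>N \<ge> 1\<close> by (simp add: less_divide_eq mult.commute)
      from \<delta>(2)[OF mem[OF y(1)] this]
      have "cmod (q (?l y) - q (?l s) - (\<Sum>j = 1..n. D j * (?l y j - ?l s j)))
          \<le> e / N * L2_set (\<lambda>j. cmod (?l y j - ?l s j)) {1..n}" .
      also have "\<dots> \<le> e / N * (N * cmod (y - s))"
        using L2[of y] \<open>e > 0\<close> \<open>N \<ge> 1\<close> by (intro mult_left_mono) auto
      also have "\<dots> = e * cmod (y - s)" using \<open>N \<ge> 1\<close> by simp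
      also have "(\<Sum>j = 1..n. D j * (?l y j - ?l s j)) = (\<Sum>j=1..n. D j * c j) * (y - s)"
        unfolding sum_distrib_right by (intro sum.cong) (auto simp: algebra_simps)
      finally show "cmod (q (?l y) - q (?l s) - (\<Sum>j=1..n. D j * c j) * (y - s)) \<le> e * cmod (y - s)" .
    qed
  qed
  then show "\<exists>f'. ((\<lambda>t. q (?l t)) has_field_derivative f') (at s within U)" by blast
qed

lemma sep_holomorphic_if_holomorphic:
  assumes q: "holomorphic_on_polydisc n q" and "bounded_on_compacts n q"
  shows "sep_holomorphic n q"
  unfolding sep_holomorphic_def
proof (intro conjI ballI)
  fix z j assume z: "z \<in> polydisc n" and j: "j \<in> {1..n}"
  \<comment> \<open>A coordinate slice is the line from \<open>z(j := 0)\<close> in the direction of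
    the unit vector \<open>j\<close>.\<close>
  have eq: "z(j := t) = (\<lambda>k\<in>{1..n}. (z(j := 0)) k + t * (if k = j then 1 else 0))" for t
    using z j by (auto simp: polydisc_def PiE_def extensional_def fun_eq_iff)
  have "(\<lambda>t. q (\<lambda>k\<in>{1..n}. (z(j := 0)) k + t * (if k = j then 1 else 0))) holomorphic_on ball 0 1"
    by (rule holomorphic_on_polydisc_line[OF q open_ball], subst eq[symmetric], rule polydisc_upd[OF z j]) simp
  then show "(\<lambda>t. q (z(j := t))) holomorphic_on ball 0 1"
    by (simp only: eq[symmetric])
qed fact

section \<open>From bounded functions to Toeplitz contractions\<close>

text \<open>Encode the input as the polynomial with \<open>x j\<close> at degree
  \<open>d - j\<close>. In its product with \<open>\<Sum>k=1..d. A k * z ^ k\<close>, the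
  coefficient at degree \<open>d + 1 - i\<close> is entry \<open>i\<close> of the output; the shift
  by one arises because the symbol starts at degree 1. Multiplication by a function bounded by 1
  does not increase the modulus, so \<open>taylor_coeffs_norm_le\<close> applies.\<close>

lemma toeplitz_contraction_of_bounded_holomorphic:
  fixes A x :: "nat \<Rightarrow> complex"
  assumes R: "R holomorphic_on ball 0 1"
    and Rb: "\<And>z. cmod z \<le> 1/2 \<Longrightarrow> cmod (R z) \<le> C * cmod z ^ Suc d"
    and le1: "\<And>z. cmod z < 1 \<Longrightarrow> cmod ((\<Sum>k=1..d. A k * z ^ k) + R z) \<le> 1"
  shows "(\<Sum>i=1..d. (cmod (\<Sum>j=1..d. if i \<le> j then A (j - i + 1) * x j else 0))\<^sup>2)
           \<le> (\<Sum>j=1..d. (cmod (x j))\<^sup>2)"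
proof -
  obtain S where S: "S holomorphic_on ball 0 1" "S 0 = 0" "\<And>z. R z = z ^ d * S z"
    using holomorphic_factor_power[OF R Rb] by blast
  define y where "y i = (\<Sum>j=1..d. if i \<le> j then A (j - i + 1) * x j else 0)" for i
  \<comment> \<open>Input degrees run over \<open>0..d-1\<close> and output degrees over
    \<open>1..d\<close>; zero padding brings both to \<open>{..d}\<close>.\<close>
  define b where "b m = (if m = d then 0 else x (d - m))" for m
  define c where "c m = (if m = 0 then 0 else y (d + 1 - m))" for m
  \<comment> \<open>The terms of the product of degree above \<open>d\<close>, divided by
    \<open>z ^ d\<close>. The exponents \<open>k - j\<close> are positive, hence
    \<open>E 0 = 0\<close>.\<close>
  define E where "E z = (\<Sum>j=1..d. \<Sum>k=1..d. if j < k then A k * x j * z ^ (k - j) else 0)" for z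
  \<comment> \<open>Stated for general \<open>G\<close>, as for \<open>cs\<close> below, to reindex
    both the polynomials and the sums of squared moduli.\<close>
  have bs: "(\<Sum>m\<le>d. G m (b m)) = (\<Sum>j=1..d. G (d - j) (x j))" if "\<And>m. G m 0 = 0"
    for G :: "nat \<Rightarrow> complex \<Rightarrow> 'b::comm_monoid_add"
  proof -
    have "(\<Sum>m\<le>d. G m (b m)) = (\<Sum>m<d. G m (b m))"
      using that by (simp add: lessThan_Suc_atMost[symmetric] b_def)
    also have "\<dots> = (\<Sum>j=1..d. G (d - j) (x j))"
      by (rule sum.reindex_bij_witness[of _ "\<lambda>j. d - j" "\<lambda>m. d - m"]) (auto simp: b_def)
    finally show ?thesis .
  qed
  have cs: "(\<Sum>m\<le>d. G m (c m)) = (\<Sum>j=1..d. G (d + 1 - j) (y j))" if "\<And>m. G m 0 = 0"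
    for G :: "nat \<Rightarrow> complex \<Rightarrow> 'b::comm_monoid_add"
  proof -
    have "(\<Sum>m\<le>d. G m (c m)) = (\<Sum>m=1..d. G m (c m))"
      using that by (intro sum.mono_neutral_right) (auto simp: c_def)
    also have "\<dots> = (\<Sum>j=1..d. G (d + 1 - j) (y j))"
      by (rule sum.reindex_bij_witness[of _ "\<lambda>j. d + 1 - j" "\<lambda>m. d + 1 - m"]) (auto simp: c_def)
    finally show ?thesis .
  qed
  have expand: "(\<Sum>k=1..d. A k * z ^ k) * (\<Sum>m\<le>d. b m * z ^ m) = (\<Sum>m\<le>d. c m * z ^ m) + z ^ d * E z" for z
  proof -
    have inner: "(\<Sum>i=1..d. if i \<le> j then A (j - i + 1) * x j * z ^ (d + 1 - i) else 0)
        = (\<Sum>k=1..d. if k \<le> j then A k * x j * z ^ (k + (d - j)) else 0)" if "j \<in> {1..d}" for j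
    proof -
      have "(\<Sum>i=1..d. if i \<le> j then A (j - i + 1) * x j * z ^ (d + 1 - i) else 0)
          = (\<Sum>i=1..j. A (j - i + 1) * x j * z ^ (d + 1 - i))"
        using that by (intro sum.mono_neutral_cong_right) auto
      also have "\<dots> = (\<Sum>k=1..j. A k * x j * z ^ (k + (d - j)))"
        using that by (intro sum.reindex_bij_witness[of _ "\<lambda>k. j + 1 - k" "\<lambda>i. j + 1 - i"])
          (auto simp: Suc_diff_le)
      also have "\<dots> = (\<Sum>k=1..d. if k \<le> j then A k * x j * z ^ (k + (d - j)) else 0)"
        using that by (intro sum.mono_neutral_cong_left) auto
      finally show ?thesis .
    qed
    have "(\<Sum>k=1..d. A k * z ^ k) * (\<Sum>m\<le>d. b m * z ^ m)
        = (\<Sum>j=1..d. \<Sum>k=1..d. A k * x j * z ^ (k + (d - j)))"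
      unfolding bs[of "\<lambda>m u. u * z ^ m", OF mult_zero_left] sum_product
      by (subst sum.swap) (simp only: power_add mult_ac)
    also have "\<dots> = (\<Sum>j=1..d. \<Sum>k=1..d. (if k \<le> j then A k * x j * z ^ (k + (d - j)) else 0)
        + z ^ d * (if j < k then A k * x j * z ^ (k - j) else 0))"
    proof (intro sum.cong refl)
      fix j k assume jk: "j \<in> {1..d}" "k \<in> {1..d}"
      show "A k * x j * z ^ (k + (d - j)) = (if k \<le> j then A k * x j * z ^ (k + (d - j)) else 0)
          + z ^ d * (if j < k then A k * x j * z ^ (k - j) else 0)"
      proof (cases "k \<le> j")
        case False
        then have "k + (d - j) = d + (k - j)" using jk by simp
        then have "z ^ (k + (d - j)) = z ^ d * z ^ (k - j)" by (simp only: power_add)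
        moreover have "j < k" using False by simp
        ultimately show ?thesis using False by (simp only: mult_ac if_False if_True add_0_left)
      qed simp
    qed
    also have "\<dots> = (\<Sum>j=1..d. \<Sum>i=1..d. if i \<le> j then A (j - i + 1) * x j * z ^ (d + 1 - i) else 0)
        + z ^ d * E z"
      using inner by (simp add: sum.distrib E_def sum_distrib_left)
    also have "(\<Sum>j=1..d. \<Sum>i=1..d. if i \<le> j then A (j - i + 1) * x j * z ^ (d + 1 - i) else 0)
        = (\<Sum>m\<le>d. c m * z ^ m)"
      by (subst cs, simp, subst sum.swap)
        (auto intro!: sum.cong simp: y_def sum_distrib_right)
    finally show ?thesis .
  qed
  have "(\<Sum>m\<le>d. (cmod (c m))\<^sup>2) \<le> (\<Sum>m\<le>d. (cmod (b m))\<^sup>2)"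
  proof (rule taylor_coeffs_norm_le)
    \<comment> \<open>The whole tail after removing \<open>z ^ d\<close>: the high-degree terms
      together with the contribution of \<open>R\<close>.\<close>
    show "(\<lambda>z. E z + S z * (\<Sum>m\<le>d. b m * z ^ m)) holomorphic_on ball 0 1"
    proof -
      have "(\<lambda>z. if j < k then A k * x j * z ^ (k - j) else 0) holomorphic_on ball 0 1" for j k
        by (cases "j < k") (auto intro!: holomorphic_intros)
      then show ?thesis
        unfolding E_def by (intro holomorphic_intros S)
    qed
    show "E 0 + S 0 * (\<Sum>m\<le>d. b m * 0 ^ m) = 0"
      using S(2) by (auto simp: E_def intro!: sum.neutral)
    fix z :: complex assume z: "cmod z < 1"
    have "(\<Sum>m\<le>d. c m * z ^ m) + z ^ d * (E z + S z * (\<Sum>m\<le>d. b m * z ^ m))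
        = ((\<Sum>k=1..d. A k * z ^ k) + R z) * (\<Sum>m\<le>d. b m * z ^ m)"
      unfolding distrib_right distrib_left expand S(3) by (simp only: add_ac mult_ac)
    then show "cmod ((\<Sum>m\<le>d. c m * z ^ m) + z ^ d * (E z + S z * (\<Sum>m\<le>d. b m * z ^ m)))
        \<le> cmod (\<Sum>m\<le>d. b m * z ^ m)"
      using le1[OF z] by (simp add: norm_mult mult_left_le_one_le)
  qed
  then show ?thesis
    using bs[of "\<lambda>_ u. (cmod u)\<^sup>2"] cs[of "\<lambda>_ u. (cmod u)\<^sup>2"] by (simp add: y_def)
qed

text \<open>Multiplication operators act pointwise, so the operator applies a scalar Toeplitz matrix
  at each \<open>t\<close>. Integrating the scalar inequality gives the norm bound; the same
  inequality dominates each output component, which makes it square integrable.\<close>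

lemma L2_contraction_toeplitz:
  assumes meas [measurable]: "\<And>k. \<phi> k \<in> borel_measurable M"
    and contr: "\<And>t x. t \<in> space M \<Longrightarrow>
      (\<Sum>i=1..d. (cmod (\<Sum>j=1..d. if i \<le> j then \<phi> (j - i + 1) t * x j else 0))\<^sup>2)
        \<le> (\<Sum>j=1..d. (cmod (x j))\<^sup>2)"
  shows "L2_contraction M d (toeplitz_op d (\<lambda>k. mult_op (\<phi> k)))"
proof -
  let ?T = "toeplitz_op d (\<lambda>k. mult_op (\<phi> k))"
  have T: "?T x i = (\<lambda>t. \<Sum>j=1..d. if i \<le> j then \<phi> (j - i + 1) t * x j t else 0)" if "i \<in> {1..d}" for x i
    using that by (auto simp: toeplitz_op_def block_op_def mult_op_def fun_eq_iff intro!: sum.cong)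
  have bound: "(\<Sum>i=1..d. (cmod (?T x i t))\<^sup>2) \<le> (\<Sum>j=1..d. (cmod (x j t))\<^sup>2)" if "t \<in> space M" for x t
    using contr[OF that, of "\<lambda>j. x j t"] T by simp
  have int: "integrable M (\<lambda>t. \<Sum>j=1..d. (cmod (x j t))\<^sup>2)" if "x \<in> L2_tuples M d" for x
    using that by (intro Bochner_Integration.integrable_sum) (auto simp: L2_tuples_def L2_space_def PiE_def Pi_def)
  have mem: "?T x i \<in> L2_space M" if x: "x \<in> L2_tuples M d" and i: "i \<in> {1..d}" for x i
  proof -
    have xm [measurable]: "x j \<in> borel_measurable M" if "j \<in> {1..d}" for j
      using x that by (auto simp: L2_tuples_def L2_space_def PiE_def Pi_def)
    have m [measurable]: "?T x i \<in> borel_measurable M"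
    proof -
      have "(\<lambda>t. if i \<le> j then \<phi> (j - i + 1) t * x j t else 0) \<in> borel_measurable M" if "j \<in> {1..d}" for j
        using xm[OF that] by (cases "i \<le> j") auto
      then show ?thesis
        unfolding T[OF i] by (intro borel_measurable_sum) auto
    qed
    have "integrable M (\<lambda>t. (cmod (?T x i t))\<^sup>2)"
    proof (rule Bochner_Integration.integrable_bound[OF int[OF x]])
      show "AE t in M. norm ((cmod (?T x i t))\<^sup>2) \<le> norm (\<Sum>j=1..d. (cmod (x j t))\<^sup>2)"
      proof (rule AE_I2)
        fix t assume t: "t \<in> space M"
        have "(cmod (?T x i t))\<^sup>2 \<le> (\<Sum>i=1..d. (cmod (?T x i t))\<^sup>2)"
          using i by (intro member_le_sum) auto
        with bound[OF t, of x] show "norm ((cmod (?T x i t))\<^sup>2) \<le> norm (\<Sum>j=1..d. (cmod (x j t))\<^sup>2)"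
          by (simp add: sum_nonneg)
      qed
    qed measurable
    with m show ?thesis by (simp add: L2_space_def)
  qed
  have Tmem: "?T x \<in> L2_tuples M d" if "x \<in> L2_tuples M d" for x
    using mem[OF that] by (auto simp: L2_tuples_def toeplitz_op_def block_op_def)
  have sq: "L2_tuple_norm M d x = sqrt (LINT t|M. (\<Sum>j=1..d. (cmod (x j t))\<^sup>2))" if "x \<in> L2_tuples M d" for x
  proof -
    have "(\<Sum>j=1..d. (L2_norm M (x j))\<^sup>2) = (\<Sum>j=1..d. LINT t|M. (cmod (x j t))\<^sup>2)"
      by (simp add: L2_norm_def)
    also have "\<dots> = (LINT t|M. (\<Sum>j=1..d. (cmod (x j t))\<^sup>2))"
      using that by (intro Bochner_Integration.integral_sum[symmetric])
        (auto simp: L2_tuples_def L2_space_def PiE_def Pi_def)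
    finally show ?thesis by (simp add: L2_tuple_norm_def L2_set_def)
  qed
  show ?thesis
    unfolding L2_contraction_def
  proof (intro conjI ballI allI)
    show "?T x \<in> L2_tuples M d" if "x \<in> L2_tuples M d" for x
      using Tmem that .
    show "AE t in M. ?T (\<lambda>j\<in>{1..d}. \<lambda>s. c * x j s + y j s) i t = c * ?T x i t + ?T y i t"
      if "i \<in> {1..d}" for x y c i
      unfolding T[OF that]
      by (auto simp: sum_distrib_left algebra_simps simp flip: sum.distrib intro!: sum.cong)
    show "L2_tuple_norm M d (?T x) \<le> L2_tuple_norm M d x" if "x \<in> L2_tuples M d" for x
      using that by (simp only: sq Tmem) (intro real_sqrt_le_mono integral_mono int bound Tmem)
  qed
qed

section \<open>The torus and the polynomial\<close>

lemma norm_torus: "t \<in> space (torus_measure m) \<Longrightarrow> j \<in> {1..m} \<Longrightarrow> cmod (t j) = 1"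
  by (auto simp: torus_measure_def circle_measure_def space_PiM space_restrict_space PiE_def Pi_def)

lemma borel_measurable_torus_poly:
  "torus_poly n a k \<in> borel_measurable (torus_measure (n - 1))"
proof -
  have comp: "(\<lambda>z. z j) \<in> borel_measurable (torus_measure (n - 1))" if "j \<in> {1..n - 1}" for j
  proof -
    have "(\<lambda>z. z j) \<in> measurable (torus_measure (n - 1)) circle_measure"
      unfolding torus_measure_def using that by (rule measurable_component_singleton)
    \<comment> \<open>\<open>circle_measure\<close> carries the trace sigma-algebra on the circle,
      so the inclusion into the plane has to be composed with the coordinate map.\<close>
    moreover have "(\<lambda>z. z) \<in> measurable circle_measure borel"
      by (simp add: circle_measure_def measurable_restrict_space1)
    ultimately show ?thesis by (rule measurable_compose)
  qed
  show ?thesis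
    unfolding torus_poly_def[abs_def]
    by (intro borel_measurable_sum borel_measurable_times borel_measurable_const
        borel_measurable_prod comp) (auto simp: index_tuples_def PiE_def Pi_def)
qed

lemma poly_fun_bounded:
  assumes "z \<in> polydisc n"
  shows "cmod (poly_fun n d a z) \<le> (\<Sum>k=1..d. \<Sum>i\<in>index_tuples n k. cmod (a (tuple_mi k i)))"
  unfolding poly_fun_def
proof (intro sum_norm_le)
  fix k i assume i: "i \<in> index_tuples n k"
  have "cmod (\<Prod>r=1..k. z (i r)) \<le> 1"
    unfolding prod_norm[symmetric]
    using i polydisc_norm_less[OF assms] by (intro prod_le_1) (force simp: index_tuples_def PiE_def Pi_def intro: less_imp_le)
  then show "cmod (a (tuple_mi k i) * (\<Prod>r=1..k. z (i r))) \<le> cmod (a (tuple_mi k i))"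
    by (simp add: norm_mult mult_left_le)
qed

text \<open>The homogeneous part of degree \<open>k\<close> scales by \<open>z ^ k\<close>, so its
  value at \<open>w\<close> becomes the coefficient of \<open>z ^ k\<close>.\<close>

lemma poly_fun_line:
  "poly_fun n d a (\<lambda>j\<in>{1..n}. z * w j) =
     (\<Sum>k=1..d. (\<Sum>i\<in>index_tuples n k. a (tuple_mi k i) * (\<Prod>r=1..k. w (i r))) * z ^ k)"
proof -
  have "(\<Prod>r=1..k. (\<lambda>j\<in>{1..n}. z * w j) (i r)) = z ^ k * (\<Prod>r=1..k. w (i r))"
    if "i \<in> index_tuples n k" for i k
  proof -
    have "(\<Prod>r=1..k. (\<lambda>j\<in>{1..n}. z * w j) (i r)) = (\<Prod>r=1..k. z * w (i r))"
      using that by (intro prod.cong) (auto simp: index_tuples_def PiE_def Pi_def)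
    then show ?thesis by (simp add: prod.distrib)
  qed
  then show ?thesis
    unfolding poly_fun_def sum_distrib_right by (intro sum.cong refl) (simp only: mult_ac)
qed

theorem theorem3p8:
  fixes n d :: nat and a :: "(nat \<Rightarrow> nat) \<Rightarrow> complex"
  assumes "n \<ge> 1" and "d \<ge> 1"
    and "poly_fun_has_degree n d a d"
    and "\<exists>q. holomorphic_on_polydisc n q \<and>
           (\<forall>I \<in> multi_indices n. mi_abs n I \<le> d \<longrightarrow> multi_deriv n I q (origin n) = 0) \<and>
           (SUP z \<in> polydisc n. ereal (cmod (poly_fun n d a z + q z))) \<le> 1"
  shows "L2_contraction (torus_measure (n - 1)) d
           (toeplitz_op d (\<lambda>k. mult_op (torus_poly n a k)))"
proof -
  obtain q where q: "holomorphic_on_polydisc n q"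
    and q0: "\<And>I. I \<in> multi_indices n \<Longrightarrow> mi_abs n I \<le> d \<Longrightarrow> multi_deriv n I q (origin n) = 0"
    and SUP: "(SUP z \<in> polydisc n. ereal (cmod (poly_fun n d a z + q z))) \<le> 1"
    using assms(4) by blast
  have le1: "cmod (poly_fun n d a z + q z) \<le> 1" if "z \<in> polydisc n" for z
    using SUP_upper2[OF that order_refl, of "\<lambda>z. ereal (cmod (poly_fun n d a z + q z))"] SUP
    by (metis ereal_less_eq(3) one_ereal_def order_trans)
  \<comment> \<open>A bound for the polynomial on the polydisc; writing \<open>q\<close> as
    \<open>(p + q) - p\<close> then bounds \<open>q\<close> by \<open>1 + B\<close>.\<close>
  define B where "B = (\<Sum>k=1..d. \<Sum>i\<in>index_tuples n k. cmod (a (tuple_mi k i)))"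
  have "cmod (q z) \<le> 1 + B" if "z \<in> polydisc n" for z
    using le1[OF that] poly_fun_bounded[OF that, of d a]
      norm_triangle_ineq4[of "poly_fun n d a z + q z" "poly_fun n d a z"]
    by (simp add: B_def)
  then have "sep_holomorphic n q"
    by (intro sep_holomorphic_if_holomorphic q) (auto simp: bounded_on_compacts_def)
  \<comment> \<open>With \<open>m = n\<close> no coordinate is forced to be 0, and
    \<open>Suc d\<close> turns the condition on orders into
    \<open>mi_abs n I \<le> d\<close>.\<close>
  from norm_le_power_of_multi_deriv_eq_0[OF this order_refl, of "Suc d"] q0
  obtain C where C: "\<And>\<rho> z. z \<in> polydisc n \<Longrightarrow> (\<forall>j\<in>{1..n}. cmod (z j) \<le> \<rho>) \<Longrightarrow> \<rho> \<le> 1/2 \<Longrightarrow>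
      cmod (q z) \<le> C * \<rho> ^ Suc d"
    by (auto simp: less_Suc_eq_le)
  show ?thesis
  proof (rule L2_contraction_toeplitz[OF borel_measurable_torus_poly])
    fix t x assume t: "t \<in> space (torus_measure (n - 1))"
    \<comment> \<open>The direction for which the coefficients along the line are
      \<open>torus_poly n a k t\<close>; \<open>w 1\<close> is an empty product.\<close>
    define w where "w i = (\<Prod>j=n-i+1..n-1. t j)" for i
    have w: "cmod (w i) = 1" if "i \<in> {1..n}" for i
      unfolding w_def prod_norm[symmetric] using norm_torus[OF t] that by (intro prod.neutral) auto
    have mem: "(\<lambda>j\<in>{1..n}. z * w j) \<in> polydisc n" if "cmod z < 1" for z
      using that w by (auto simp: polydisc_def norm_mult)
    have tp: "torus_poly n a k t = (\<Sum>i\<in>index_tuples n k. a (tuple_mi k i) * (\<Prod>r=1..k. w (i r)))" for k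
      by (simp add: torus_poly_def w_def)
    show "(\<Sum>i=1..d. (cmod (\<Sum>j=1..d. if i \<le> j then torus_poly n a (j - i + 1) t * x j else 0))\<^sup>2)
        \<le> (\<Sum>j=1..d. (cmod (x j))\<^sup>2)"
    proof (rule toeplitz_contraction_of_bounded_holomorphic)
      show "(\<lambda>z. q (\<lambda>j\<in>{1..n}. z * w j)) holomorphic_on ball 0 1"
        using holomorphic_on_polydisc_line[OF q open_ball, of 0 1 "\<lambda>_. 0" w] mem by simp
      \<comment> \<open>Every coordinate of the point has modulus \<open>cmod z\<close>, which
        therefore serves as \<open>\<rho>\<close>.\<close>
      show "cmod (q (\<lambda>j\<in>{1..n}. z * w j)) \<le> C * cmod z ^ Suc d" if "cmod z \<le> 1/2" for z
        using that w by (intro C mem) (auto simp: norm_mult)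
      show "cmod ((\<Sum>k=1..d. torus_poly n a k t * z ^ k) + q (\<lambda>j\<in>{1..n}. z * w j)) \<le> 1"
        if "cmod z < 1" for z
        using le1[OF mem[OF that]] by (simp only: poly_fun_line tp)
    qed
  qed
qed

end
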